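(* (Generalization of the Quintuple Product Identity) Let $a$ be a positive integer and let $q$ be a complex number with $0<|q|<1$. Then, as an identity of meromorphic functions of $z\in\mathbb{C}\setminus\{0\}$, $$\frac{[z^a;q]_\infty}{[z,z^{a+1};q]_\infty}=\frac{E(q^{a+1})^2}{E(q)^2}\sum_{j=0}^{a-1}z^j\,\frac{[q^{a-j};q^{a+1}]_\infty}{[z^{a+1},z^{a+1}q^{a-j};q^{a+1}]_\infty}.$$
   Context: $E(q):=\prod_{n=1}^\infty(1-q^n)$. For $|q|<1$ and $z\ne0$, $[z;q]_\infty:=\prod_{n=1}^\infty(1-zq^{n-1})(1-z^{-1}q^n)$, and $[z_1,z_2;q]_\infty:=[z_1;q]_\infty[z_2;q]_\infty$. *)

theory Defs
  imports "HOL-Complex_Analysis.Complex_Analysis"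
begin

definition euler_E :: "complex \<Rightarrow> complex" where
  "euler_E q = (\<Prod>n. 1 - q ^ Suc n)"

text \<open>
  The paper's products run over \<open>n \<ge> 1\<close>; here \<open>n\<close> is shifted to start at \<open>0\<close>.
  Both definitions are meant for \<open>norm q < 1\<close> and the brackets for nonzero arguments. A vanishing
  factor is harmless: \<^const>\<open>prodinf\<close> then yields \<open>0\<close>, as it should.
\<close>

definition qbracket :: "complex \<Rightarrow> complex \<Rightarrow> complex" where
  "qbracket z q = (\<Prod>n. (1 - z * q ^ n) * (1 - inverse z * q ^ Suc n))"

definition qbracket2 :: "complex \<Rightarrow> complex \<Rightarrow> complex \<Rightarrow> complex" where
  "qbracket2 z1 z2 q = qbracket z1 q * qbracket z2 q"

end

theory Submission
  imports Defs
begin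

text \<open>
  Write \<open>\<theta>(z;q) = [z;q]\<close> and \<open>N = a + 1\<close>, \<open>Q = q\<^sup>N\<close>. The identity is the case \<open>x = 1/z\<close>, \<open>y = z\<^sup>N\<close> of
  \<open>E(q)\<^sup>2 \<theta>(xy;q) / (\<theta>(x;q) \<theta>(y;q))
    = E(Q)\<^sup>2 \<Sum>r<N. x\<^sup>r \<theta>(x\<^sup>N y q\<^sup>r;Q) / (\<theta>(x\<^sup>N;Q) \<theta>(y q\<^sup>r;Q))\<close>,
  which dissects Kronecker's bilateral series \<open>\<Sum>n. x\<^sup>n / (1 - y q\<^sup>n)\<close> modulo \<open>N\<close>; the summand \<open>r = 0\<close> vanishes.
  For fixed \<open>x\<close> the difference \<open>D(y)\<close> of both sides satisfies \<open>D(qy) = D(y)/x\<close>, its residue at \<open>y = 1\<close> is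
  zero, and hence all its singularities on the punctured plane, which lie at the powers of \<open>q\<close>, are removable.
  For large \<open>m\<close> the function \<open>y\<^sup>m D(y)\<close> is then entire, and the functional equation kills each of its Taylor
  coefficients, because \<open>1/x\<close> is not a power of \<open>q\<close>.
\<close>

section \<open>Infinite q-Pochhammer symbols and the theta brackets built from them\<close>

definition qpoch :: "complex \<Rightarrow> complex \<Rightarrow> complex" where
  "qpoch z q = (\<Prod>n. 1 - z * q ^ n)"

lemma convergent_prod_qpoch:
  fixes q z :: complex
  assumes "norm q < 1"
  shows "convergent_prod (\<lambda>n. 1 - z * q ^ n)"
proof -
  have "summable (\<lambda>n. norm (1 - z * q ^ n - 1))"
    using assms by (simp add: norm_mult norm_power summable_mult)
  then show ?thesis
    by (intro abs_convergent_prod_imp_convergent_prod summable_imp_abs_convergent_prod)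
qed

lemma qpoch_rec:
  assumes "norm q < 1"
  shows "qpoch z q = (1 - z) * qpoch (z * q) q"
proof -
  have "(\<lambda>n. 1 - z * q ^ n) has_prod ((1 - z) * qpoch (z * q) q)"
    using has_prod_ignore_initial_segment'[OF convergent_prod_qpoch[OF assms, of z], of 1]
    by (simp add: qpoch_def mult_ac)
  then show ?thesis
    unfolding qpoch_def by (rule has_prod_unique[symmetric])
qed

lemma qpoch_eq_0_iff:
  assumes "norm q < 1"
  shows "qpoch z q = 0 \<longleftrightarrow> (\<exists>n. z * q ^ n = 1)"
proof -
  have "(\<lambda>n. 1 - z * q ^ n) has_prod qpoch z q"
    unfolding qpoch_def using convergent_prod_qpoch[OF assms] by (rule convergent_prod_has_prod)
  from has_prod_eq_0_iff[OF this] show ?thesis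
    by (auto simp: image_iff)
qed

text \<open>The partial products are entire and converge uniformly on every closed unit disc, by the
  M-test with majorant \<open>(norm x + 1) * norm q ^ n\<close>.\<close>

lemma holomorphic_qpoch:
  assumes "norm q < 1"
  shows "(\<lambda>z. qpoch z q) holomorphic_on UNIV"
proof (rule holomorphic_uniform_sequence[where f = "\<lambda>N z. \<Prod>n<N. 1 - z * q ^ n"])
  show "\<exists>d>0. cball x d \<subseteq> UNIV \<and>
      uniform_limit (cball x d) (\<lambda>N z. \<Prod>n<N. 1 - z * q ^ n) (\<lambda>z. qpoch z q) sequentially"
    for x :: complex
  proof (intro exI[of _ 1] conjI)
    have "uniformly_convergent_on (cball x 1) (\<lambda>N z. \<Sum>n<N. norm ((1 - z * q ^ n) - 1))"
    proof (rule Weierstrass_m_test')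
      show "summable (\<lambda>n. (norm x + 1) * norm q ^ n)"
        using assms by (intro summable_mult summable_geometric) auto
      show "norm (norm ((1 - z * q ^ n) - 1)) \<le> (norm x + 1) * norm q ^ n"
        if "z \<in> cball x 1" for n z
      proof -
        have "norm z \<le> norm x + 1"
          using that norm_triangle_ineq3[of x z] by (simp add: dist_norm)
        then show ?thesis
          by (simp add: norm_mult norm_power mult_right_mono)
      qed
    qed
    then have "uniformly_convergent_on (cball x 1) (\<lambda>N z. \<Prod>n<N. 1 - z * q ^ n)"
      by (intro uniformly_convergent_on_prod') (auto intro!: continuous_intros)
    moreover have "lim (\<lambda>N. \<Prod>n<N. 1 - z * q ^ n) = qpoch z q" for z
      unfolding qpoch_def
      using convergent_prod_has_prod[OF convergent_prod_qpoch[OF assms], THEN has_prod_imp_tendsto']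
      by (rule limI)
    ultimately show "uniform_limit (cball x 1) (\<lambda>N z. \<Prod>n<N. 1 - z * q ^ n)
        (\<lambda>z. qpoch z q) sequentially"
      by (simp add: uniformly_convergent_uniform_limit_iff)
  qed auto
qed (auto intro!: holomorphic_intros)

lemma analytic_on_qpoch [analytic_intros]:
  assumes "norm q < 1" "f analytic_on A"
  shows "(\<lambda>z. qpoch (f z) q) analytic_on A"
  using analytic_on_compose[OF assms(2), of "\<lambda>z. qpoch z q"] holomorphic_qpoch[OF assms(1)]
  by (simp add: o_def analytic_on_subset[of _ UNIV] analytic_on_open)

lemma qbracket_eq_qpoch:
  assumes "norm q < 1"
  shows "qbracket z q = qpoch z q * qpoch (q / z) q"
  using prodinf_mult[OF convergent_prod_qpoch[OF assms, of z] convergent_prod_qpoch[OF assms, of "q / z"]]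
  by (simp add: qbracket_def qpoch_def field_simps)

lemma euler_E_eq_qpoch: "euler_E q = qpoch q q"
  by (simp add: euler_E_def qpoch_def)

text \<open>Each factor is \<open>1 - q ^ (s + t * n)\<close> with a positive exponent, so the
  subtracted power has norm below 1.\<close>

lemma qpoch_power_nonzero:
  assumes "norm q < 1" "s > 0" "t > 0"
  shows "qpoch (q ^ s) (q ^ t) \<noteq> 0"
proof -
  have "norm (q ^ (s + t * n)) < 1" for n
    using assms by (simp add: norm_power power_less_one_iff)
  then have "q ^ s * (q ^ t) ^ n \<noteq> 1" for n
    by (metis norm_one order_less_irrefl power_add power_mult)
  moreover have "norm (q ^ t) < 1"
    using assms by (simp add: norm_power power_less_one_iff)
  ultimately show ?thesis
    by (simp add: qpoch_eq_0_iff)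
qed

lemma euler_E_nonzero:
  assumes "norm q < 1"
  shows "euler_E q \<noteq> 0"
  using qpoch_power_nonzero[OF assms, of 1 1] by (simp add: euler_E_eq_qpoch)

lemma analytic_on_qbracket [analytic_intros]:
  assumes "norm q < 1" "f analytic_on A" "\<And>z. z \<in> A \<Longrightarrow> f z \<noteq> 0"
  shows "(\<lambda>z. qbracket (f z) q) analytic_on A"
  unfolding qbracket_eq_qpoch[OF assms(1)] using assms by (auto intro!: analytic_intros)

text \<open>Passing from \<open>z\<close> to \<open>q * z\<close> trades the factor
  \<open>1 - z\<close> for \<open>1 - 1 / z\<close>, which is \<open>- (1 - z) / z\<close>.\<close>

lemma qbracket_shift:
  assumes "norm q < 1" "q \<noteq> 0" "z \<noteq> 0"
  shows "qbracket (q * z) q = - qbracket z q / z"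
proof -
  have "qbracket (q * z) q = qpoch (z * q) q * ((1 - 1 / z) * qpoch (q / z) q)"
    using assms by (simp add: qbracket_eq_qpoch qpoch_rec[of q "1 / z"] mult_ac)
  also have "\<dots> = - ((1 - z) * qpoch (z * q) q) * qpoch (q / z) q / z"
    using assms by (simp add: field_simps)
  also have "\<dots> = - qbracket z q / z"
    using qpoch_rec[OF assms(1), of z] by (simp add: qbracket_eq_qpoch assms)
  finally show ?thesis .
qed

lemma qbracket_inverse:
  assumes "norm q < 1" "q \<noteq> 0" "z \<noteq> 0"
  shows "qbracket (1 / z) q = - qbracket z q / z"
  using qbracket_shift[OF assms] assms by (simp add: qbracket_eq_qpoch mult_ac)

lemma qbracket_1 [simp]:
  assumes "norm q < 1"
  shows "qbracket 1 q = 0"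
  using qpoch_rec[OF assms, of 1] by (simp add: qbracket_eq_qpoch assms)

text \<open>The two Pochhammer factors vanish at the nonpositive and at the positive powers of
  \<open>q\<close>. Conversely, the shift formula spreads the zero at 1 in both directions.\<close>

lemma qbracket_eq_0_iff:
  assumes "norm q < 1" "q \<noteq> 0" "z \<noteq> 0"
  shows "qbracket z q = 0 \<longleftrightarrow> (\<exists>k::int. z = q powi k)"
proof
  assume "qbracket z q = 0"
  then consider n where "z * q ^ n = 1" | n where "q / z * q ^ n = 1"
    by (auto simp: qbracket_eq_qpoch qpoch_eq_0_iff assms)
  then show "\<exists>k::int. z = q powi k"
  proof cases
    case 1
    then have "z = q powi (- int n)"
      using assms by (simp add: power_int_minus field_simps)
    then show ?thesis ..
  next
    case 2
    then have "z = q powi (int (Suc n))"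
      using assms 2 by (simp only: power_int_of_nat) (simp add: field_simps)
    then show ?thesis ..
  qed
next
  assume "\<exists>k::int. z = q powi k"
  then obtain k where k: "z = q powi k" ..
  have "qbracket (q powi k) q = 0"
  proof (induction k rule: int_induct[where k = 0])
    case (step1 i)
    then show ?case
      using qbracket_shift[OF assms(1,2), of "q powi i"] assms(2) by (simp add: power_int_add mult_ac)
  next
    case (step2 i)
    then show ?case
      using qbracket_shift[OF assms(1,2), of "q powi (i - 1)"] assms(2)
      by (simp add: power_int_diff)
  qed (simp add: assms)
  then show "qbracket z q = 0"
    by (simp add: k)
qed

section \<open>Rigidity of quasi-periodic functions on the punctured plane\<close>

text \<open>The functional equation multiplies the \<open>n\<close>-th Taylor coefficient at 0 by
  \<open>q ^ n\<close> on one side and by \<open>d\<close> on the other.\<close>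

lemma entire_scaling_eq_0:
  fixes f :: "complex \<Rightarrow> complex"
  assumes holo: "f holomorphic_on UNIV"
    and scale: "\<And>z. f (q * z) = d * f z"
    and d: "\<And>n. d \<noteq> q ^ n"
  shows "f z = 0"
proof (rule holomorphic_fun_eq_0_on_connected[OF holo, of 0])
  fix n
  have "q ^ n * (deriv ^^ n) f 0 = (deriv ^^ n) (\<lambda>w. f (q * w)) 0"
    using higher_deriv_compose_linear[OF holo, of UNIV 0 q n] by simp
  also have "\<dots> = d * (deriv ^^ n) f 0"
    unfolding scale using higher_deriv_cmult[OF holo, of 0 n d] by simp
  finally show "(deriv ^^ n) f 0 = 0"
    using d[of n] by simp
qed auto

text \<open>Scaling by \<open>q\<close> moves every point of the punctured unit disc into one
  compact annulus, on which continuous functions are bounded.\<close>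

lemma annulus_representative:
  fixes q z :: complex
  assumes "q \<noteq> 0" "norm q < 1" "z \<noteq> 0" "norm z \<le> 1"
  obtains n w where "z = q ^ n * w" "norm q \<le> norm w" "norm w \<le> 1"
proof -
  obtain m where "norm q ^ m < norm z"
    using real_arch_pow_inv[of "norm z" "norm q"] assms by auto
  then have ex: "norm q ^ Suc m \<le> norm z"
    using assms by (intro order.trans[OF power_decreasing[of m "Suc m" "norm q"]]) auto
  define n where "n = (LEAST n. norm q ^ Suc n \<le> norm z)"
  have n: "norm q ^ Suc n \<le> norm z"
    unfolding n_def using ex by (rule LeastI)
  have "norm z \<le> norm q ^ n"
  proof (cases n)
    case (Suc k)
    then have "\<not> norm q ^ Suc k \<le> norm z"
      using not_less_Least[of k "\<lambda>n. norm q ^ Suc n \<le> norm z"] by (simp add: n_def)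
    then show ?thesis
      using Suc by simp
  qed (use assms in simp)
  then show thesis
    using n assms by (intro that[of n "z / q ^ n"]) (auto simp: norm_divide norm_power field_simps)
qed

text \<open>The functional equation spreads a bound on the annulus to the punctured disc, so
  \<open>f\<close> grows at most like a negative power of \<open>z\<close> at 0. Clearing that power
  gives an entire function whose multiplier, \<open>c\<close> times a power of \<open>q\<close>, is
  still no power of \<open>q\<close>.\<close>

lemma quasi_periodic_eq_0:
  fixes f :: "complex \<Rightarrow> complex"
  assumes q: "q \<noteq> 0" "norm q < 1"
    and ana: "f analytic_on - {0}"
    and per: "\<And>z. z \<noteq> 0 \<Longrightarrow> f (q * z) = c * f z"
    and c: "\<And>k::int. c \<noteq> q powi k"
    and "z \<noteq> 0"
  shows "f z = 0"
proof -
  have holo: "f holomorphic_on - {0}"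
    using ana by (rule analytic_imp_holomorphic)
  have "(\<lambda>m. norm c * norm q ^ m) \<longlonglongrightarrow> norm c * 0"
    using q by (intro tendsto_intros) auto
  then have "\<forall>\<^sub>F m in sequentially. norm c * norm q ^ m < 1"
    by (rule order_tendstoD) simp
  then obtain m where m: "norm c * norm q ^ m < 1"
    by (auto simp: eventually_sequentially)
  \<comment> \<open>The factor \<open>z ^ m\<close> makes \<open>h\<close> bounded near \<open>0\<close>; one more factor \<open>z\<close> makes it extend to an entire function.\<close>
  define h where "h z = z ^ m * f z" for z
  have h_per: "h (q * z) = (q ^ m * c) * h z" if "z \<noteq> 0" for z
    using per[OF that] by (simp add: h_def power_mult_distrib mult_ac)
  define A where "A = cball 0 1 - ball (0::complex) (norm q)"
  have "continuous_on A h"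
    unfolding h_def A_def using q holomorphic_on_imp_continuous_on[OF holo]
    by (intro continuous_intros) (auto intro: continuous_on_subset)
  then have "bounded (h ` A)"
    by (intro compact_imp_bounded compact_continuous_image) (auto simp: A_def intro: compact_diff)
  then obtain M where M: "\<And>w. w \<in> A \<Longrightarrow> norm (h w) \<le> M"
    unfolding bounded_iff by auto
  have bound: "norm (h z) \<le> M" if z: "z \<noteq> 0" "norm z \<le> 1" for z
  proof -
    obtain n w where nw: "z = q ^ n * w" "norm q \<le> norm w" "norm w \<le> 1"
      using annulus_representative[OF q z] .
    have "w \<noteq> 0"
      using nw(1) z(1) by auto
    \<comment> \<open>Each further factor \<open>q\<close> multiplies \<open>h\<close> by
      \<open>q ^ m * c\<close>, of norm below 1 by the choice of \<open>m\<close>.\<close>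
    have "norm (h (q ^ n * w)) \<le> norm (h w)"
    proof (induction n)
      case (Suc n)
      have "norm (h (q ^ Suc n * w)) = norm (q ^ m * c) * norm (h (q ^ n * w))"
        using h_per[of "q ^ n * w"] q \<open>w \<noteq> 0\<close> by (simp add: norm_mult mult_ac)
      also have "\<dots> \<le> norm (h (q ^ n * w))"
        using m by (intro mult_left_le_one_le) (auto simp: norm_mult norm_power mult_ac)
      finally show ?case
        using Suc by simp
    qed simp
    then show ?thesis
      using M[of w] nw by (auto simp: A_def)
  qed
  define g where "g z = z * h z" for z
  have "g \<midarrow>0\<rightarrow> 0"
  proof (rule Lim_null_comparison)
    have "\<forall>\<^sub>F z in at (0::complex). z \<in> ball 0 1 - {0}"
      by (intro eventually_at_in_open) auto
    then show "\<forall>\<^sub>F z in at 0. norm (g z) \<le> norm z * M"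
      by eventually_elim (auto simp: g_def norm_mult intro!: mult_left_mono bound)
    show "((\<lambda>z::complex. norm z * M) \<longlongrightarrow> 0) (at 0)"
      by (rule tendsto_eq_intros refl | simp)+
  qed
  moreover have "g holomorphic_on UNIV - {0}"
    unfolding g_def h_def Compl_eq_Diff_UNIV[symmetric] by (intro holomorphic_intros holo)
  ultimately have "g holomorphic_on UNIV"
    by - (rule no_isolated_singularity'[of "{0}"], auto simp: g_def)
  moreover have "g (q * z) = (q ^ Suc m * c) * g z" for z
    using h_per[of z] by (cases "z = 0") (auto simp: g_def)
  moreover have "q ^ Suc m * c \<noteq> q ^ n" for n
  proof
    assume "q ^ Suc m * c = q ^ n"
    then have "c = q powi (int n - int (Suc m))"
      using q by (subst power_int_diff) (auto simp only: power_int_of_nat, simp add: field_simps)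
    then show False
      using c by blast
  qed
  ultimately have "g z = 0"
    by (rule entire_scaling_eq_0)
  then show ?thesis
    using \<open>z \<noteq> 0\<close> by (simp add: g_def h_def)
qed

text \<open>Substitute \<open>w / u\<close> for the variable. This later carries the removable
  singularity of \<open>D\<close> at 1 to all powers of \<open>q\<close>.\<close>

lemma tendsto_at_scale:
  fixes f :: "complex \<Rightarrow> complex"
  assumes "f \<midarrow>z\<rightarrow> l" "u \<noteq> 0" "z \<noteq> 0"
    and scale: "\<And>w. w \<noteq> 0 \<Longrightarrow> f (u * w) = c * f w"
  shows "f \<midarrow>u * z\<rightarrow> c * l"
proof -
  have "filterlim (\<lambda>w. w / u) (at z) (at (u * z))"
  proof (rule filterlim_atI)
    show "((\<lambda>w. w / u) \<longlongrightarrow> z) (at (u * z))"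
      using assms by (auto intro!: tendsto_eq_intros)
    show "\<forall>\<^sub>F w in at (u * z). w / u \<noteq> z"
      using assms by (auto simp: eventually_at_filter divide_eq_eq mult_ac)
  qed
  from filterlim_compose[OF assms(1) this]
  have "((\<lambda>w. c * f (w / u)) \<longlongrightarrow> c * l) (at (u * z))"
    by (intro tendsto_intros)
  moreover have "\<forall>\<^sub>F w in at (u * z). w \<noteq> 0"
    using assms by (intro eventually_neq_at_within)
  then have "\<forall>\<^sub>F w in at (u * z). c * f (w / u) = f w"
  proof eventually_elim
    case (elim w)
    then show ?case
      using scale[of "w / u"] \<open>u \<noteq> 0\<close> by simp
  qed
  ultimately show ?thesis
    by (rule Lim_transform_eventually)
qed

lemma quasi_periodic_powi:
  fixes f :: "complex \<Rightarrow> complex"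
  assumes "q \<noteq> 0" "c \<noteq> 0" "z \<noteq> 0"
    and per: "\<And>z. z \<noteq> 0 \<Longrightarrow> f (q * z) = c * f z"
  shows "f (q powi k * z) = c powi k * f z"
proof (induction k rule: int_induct[where k = 0])
  case (step1 i)
  then show ?case
    using per[of "q powi i * z"] assms(1-3) by (simp add: power_int_add mult.assoc mult.left_commute)
next
  case (step2 i)
  then show ?case
    using per[of "q powi (i - 1) * z"] assms by (simp add: power_int_diff field_simps)
qed simp

text \<open>Finite limits exclude poles, so \<open>remove_sings f\<close> is analytic off 0, and it
  inherits the functional equation through its limits. Analyticity of \<open>f\<close> at
  \<open>z\<close> ensures that \<open>f z\<close> is the limit there and not an arbitrary value at
  a singularity.\<close>

lemma quasi_periodic_meromorphic_eq_0:
  fixes f :: "complex \<Rightarrow> complex"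
  assumes q: "q \<noteq> 0" "norm q < 1"
    and mero: "f meromorphic_on - {0}"
    and per: "\<And>z. z \<noteq> 0 \<Longrightarrow> f (q * z) = c * f z"
    and c: "\<And>k::int. c \<noteq> q powi k"
    and lim: "\<And>z. z \<noteq> 0 \<Longrightarrow> \<exists>l. f \<midarrow>z\<rightarrow> l"
    and "f analytic_on {z}" "z \<noteq> 0"
  shows "f z = 0"
proof -
  have "remove_sings f analytic_on {z}" if "z \<noteq> 0" for z
    using lim[OF that] that
    by (auto intro!: remove_sings_analytic_at meromorphic_on_isolated_singularity
        meromorphic_on_subset[OF mero])
  then have "remove_sings f analytic_on - {0}"
    by (subst analytic_on_analytic_at) auto
  moreover have "remove_sings f (q * z) = c * remove_sings f z" if z: "z \<noteq> 0" for z
  proof -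
    obtain l where l: "f \<midarrow>z\<rightarrow> l"
      using lim[OF z] by blast
    show ?thesis
      using remove_sings_eqI[OF l] remove_sings_eqI[OF tendsto_at_scale[OF l q(1) z per]] by simp
  qed
  ultimately have "remove_sings f z = 0"
    using quasi_periodic_eq_0[OF q _ _ c \<open>z \<noteq> 0\<close>] by blast
  then show ?thesis
    using \<open>f analytic_on {z}\<close> by simp
qed

section \<open>Dissection of Kronecker's series modulo \<open>N\<close>\<close>

lemma kronecker_dissection:
  fixes q x y :: complex and N :: nat
  assumes q: "q \<noteq> 0" "norm q < 1" and N: "N > 0" and xy: "x \<noteq> 0" "y \<noteq> 0"
    and x_nz: "qbracket x q \<noteq> 0" "qbracket (x ^ N) (q ^ N) \<noteq> 0"
    and y_nz: "qbracket y q \<noteq> 0" "\<And>r. r < N \<Longrightarrow> qbracket (y * q ^ r) (q ^ N) \<noteq> 0"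
  shows "euler_E q ^ 2 * qbracket (x * y) q / (qbracket x q * qbracket y q) =
    euler_E (q ^ N) ^ 2 * (\<Sum>r<N. x ^ r * qbracket (x ^ N * y * q ^ r) (q ^ N) /
      (qbracket (x ^ N) (q ^ N) * qbracket (y * q ^ r) (q ^ N)))"
proof -
  define Q where "Q = q ^ N"
  have Q: "Q \<noteq> 0" "norm Q < 1"
    using q N by (auto simp: Q_def norm_power power_less_one_iff)
  define T where "T r y = x ^ r * qbracket (x ^ N * y * q ^ r) Q /
      (qbracket (x ^ N) Q * qbracket (y * q ^ r) Q)" for r y
  define D where "D y = euler_E q ^ 2 * qbracket (x * y) q / (qbracket x q * qbracket y q) -
      euler_E Q ^ 2 * (\<Sum>r<N. T r y)" for y
  have T_ana: "T r analytic_on {w}" if "w \<noteq> 0" "qbracket (w * q ^ r) Q \<noteq> 0" for r w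
    unfolding T_def using that q Q xy x_nz by (auto intro!: analytic_intros simp: Q_def)

  have per: "D (q * w) = (1 / x) * D w" if w: "w \<noteq> 0" for w
  proof -
    have "qbracket (x * (q * w)) q = - qbracket (x * w) q / (x * w)"
      using qbracket_shift[OF q(2,1), of "x * w"] xy w by (simp add: mult_ac)
    then have 1: "qbracket (x * (q * w)) q / (qbracket x q * qbracket (q * w) q) =
        (1 / x) * (qbracket (x * w) q / (qbracket x q * qbracket w q))"
      using qbracket_shift[OF q(2,1) w] xy w by simp
    have T_shift: "T r (q * w) = (1 / x) * T (Suc r) w" for r
      using xy by (simp add: T_def mult_ac)
    have "qbracket (x ^ N * w * q ^ N) Q = - qbracket (x ^ N * w) Q / (x ^ N * w)"
      using qbracket_shift[OF Q(2,1), of "x ^ N * w"] xy w by (simp add: Q_def mult_ac)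
    moreover have "qbracket (w * q ^ N) Q = - qbracket w Q / w"
      using qbracket_shift[OF Q(2,1) w] by (simp add: Q_def mult_ac)
    \<comment> \<open>The shift moves summand \<open>r\<close> to \<open>r + 1\<close>. The last one
      returns to the first: the prefactor \<open>x ^ N\<close> cancels against the two shift factors
      for base \<open>Q\<close>.\<close>
    ultimately have T_N: "T N w = T 0 w"
      using xy w by (simp add: T_def)
    have "(\<Sum>r<N. T r (q * w)) = (1 / x) * (\<Sum>r<N. T (Suc r) w)"
      by (simp add: T_shift sum_distrib_left)
    also have "(\<Sum>r<N. T (Suc r) w) = (\<Sum>r<N. T r w)"
      using sum.lessThan_Suc_shift[of "\<lambda>r. T r w" N] sum.lessThan_Suc[of "\<lambda>r. T r w" N] T_N
      by simp
    finally have 2: "(\<Sum>r<N. T r (q * w)) = (1 / x) * (\<Sum>r<N. T r w)" .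
    show ?thesis
      unfolding D_def times_divide_eq_right[symmetric] 1 2 by (simp add: algebra_simps)
  qed

  \<comment> \<open>Only the summand \<open>r = 0\<close> has a pole at \<open>1\<close>, and its residue cancels that of the left-hand side.\<close>
  have "\<exists>l. D \<midarrow>1\<rightarrow> l"
  proof -
    \<comment> \<open>This is \<open>(1 - w) * D w\<close> with the simple zero of
      \<open>qbracket w\<close> at 1 cancelled by hand for both bases, so that it is analytic at 1
      as well.\<close>
    define K where "K w =
        euler_E q ^ 2 * qbracket (x * w) q / (qbracket x q * (qpoch (w * q) q * qpoch (q / w) q)) -
        euler_E Q ^ 2 * (qbracket (x ^ N * w) Q /
            (qbracket (x ^ N) Q * (qpoch (w * Q) Q * qpoch (Q / w) Q)) +
          (1 - w) * (\<Sum>r=1..<N. T r w))" for w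
    have br: "qbracket w p = (1 - w) * (qpoch (w * p) p * qpoch (p / w) p)" if "norm p < 1" for w p
      using qpoch_rec[OF that, of w] by (simp add: qbracket_eq_qpoch[OF that])
    have D_eq: "D w = K w / (1 - w)" if "w \<noteq> 1" for w
    proof -
      have "(\<Sum>r<N. T r w) = T 0 w + (\<Sum>r=1..<N. T r w)"
        using N by (simp add: lessThan_atLeast0 sum.atLeast_Suc_lessThan)
      then show ?thesis
        using that unfolding D_def K_def br[OF q(2), of w]
        by (simp add: T_def br[OF Q(2), of w] divide_simps)
    qed
    \<comment> \<open>The Pochhammer factors are those of \<open>q ^ r\<close> and
      \<open>q ^ (N - r)\<close>, both with positive exponents; hence \<open>T r\<close> is analytic
      at 1 for \<open>r > 0\<close>.\<close>
    have "qbracket (q ^ r) Q \<noteq> 0" if "r \<in> {1..<N}" for r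
    proof -
      have "Q / q ^ r = q ^ (N - r)"
        using that q by (simp add: Q_def power_diff)
      then show ?thesis
        using that q N qpoch_power_nonzero[of q r N] qpoch_power_nonzero[of q "N - r" N]
        by (simp add: qbracket_eq_qpoch[OF Q(2)]) (simp add: Q_def)
    qed
    then have "K analytic_on {1}"
      unfolding K_def using q Q xy x_nz euler_E_nonzero[of q] euler_E_nonzero[of Q]
      by (auto intro!: analytic_intros T_ana simp: euler_E_eq_qpoch Q_def)
    then obtain K' where K': "(K has_field_derivative K') (at 1)"
      using analytic_on_imp_differentiable_at field_differentiable_def by blast
    \<comment> \<open>At 1 the Pochhammer products become \<open>euler_E q ^ 2\<close> and
      \<open>euler_E Q ^ 2\<close>, so the value is 1 - 1.\<close>
    have "K 1 = 0"
      using x_nz euler_E_nonzero[OF q(2)] euler_E_nonzero[OF Q(2)]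
      by (simp add: K_def Q_def[symmetric] flip: euler_E_eq_qpoch power2_eq_square)
    then have "((\<lambda>w. - (K w / (w - 1))) \<longlongrightarrow> - K') (at 1)"
      using K' by (intro tendsto_minus) (simp add: has_field_derivative_iff)
    moreover have "\<forall>\<^sub>F w in at 1. - (K w / (w - 1)) = D w"
      by (auto simp: eventually_at_filter D_eq field_simps)
    ultimately have "D \<midarrow>1\<rightarrow> - K'"
      by (rule Lim_transform_eventually)
    then show ?thesis ..
  qed
  then obtain l where l: "D \<midarrow>1\<rightarrow> l" ..

  have D_ana: "D analytic_on {w}"
    if "w \<noteq> 0" "qbracket w q \<noteq> 0" "\<And>r. r < N \<Longrightarrow> qbracket (w * q ^ r) Q \<noteq> 0" for w
    unfolding D_def using that q xy x_nz by (auto intro!: analytic_intros T_ana)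

  have lim: "\<exists>l. D \<midarrow>w\<rightarrow> l" if w: "w \<noteq> 0" for w
  \<comment> \<open>At powers of \<open>q\<close> the limit is transported from 1. Elsewhere no
    denominator vanishes, since a power of \<open>Q\<close> divided by \<open>q ^ r\<close> is again
    a power of \<open>q\<close>.\<close>
  proof (cases "\<exists>k::int. w = q powi k")
    case True
    then obtain k where k: "w = q powi k" ..
    have "D \<midarrow>q powi k * 1\<rightarrow> (1 / x) powi k * l"
      by (rule tendsto_at_scale[OF l]) (use q xy per in \<open>auto intro: quasi_periodic_powi\<close>)
    then show ?thesis
      using k by auto
  next
    case False
    have "qbracket (w * q ^ r) Q \<noteq> 0" for r
    proof
      assume "qbracket (w * q ^ r) Q = 0"
      then obtain k where "w * q ^ r = Q powi k"
        using qbracket_eq_0_iff[OF Q(2,1)] w q by auto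
      also have "Q powi k = q powi (int N * k)"
        by (simp only: Q_def power_int_mult power_int_of_nat)
      finally have "w = q powi (int N * k - int r)"
        using q by (simp add: power_int_diff field_simps)
      then show False
        using False by blast
    qed
    then have "D analytic_on {w}"
      using False w by (intro D_ana) (auto simp: qbracket_eq_0_iff q)
    then show ?thesis
      using analytic_at_imp_isCont isContD by blast
  qed

  have "D meromorphic_on - {0}"
    unfolding D_def T_def using q Q xy
    by (intro meromorphic_intros analytic_on_imp_meromorphic_on analytic_on_qbracket analytic_intros)
      auto
  moreover have "1 / x \<noteq> q powi k" for k
  proof
    assume "1 / x = q powi k"
    then have "x = q powi (- k)"
      using xy by (metis divide_divide_eq_right inverse_eq_divide mult_1 div_by_1 power_int_minus)
    then show False
      using x_nz(1) qbracket_eq_0_iff[OF q(2,1) xy(1)] by blast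
  qed
  moreover have "D analytic_on {y}"
    using y_nz xy by (intro D_ana) (auto simp: Q_def)
  ultimately have "D y = 0"
    using quasi_periodic_meromorphic_eq_0[OF q _ per _ lim] xy(2) by blast
  then show ?thesis
    by (simp add: D_def T_def Q_def)
qed

section \<open>Genericity of nonvanishing denominators\<close>

text \<open>By the identity theorem on the connected punctured plane, the zeros are isolated as soon
  as one nonzero value is exhibited.\<close>

lemma eventually_qbracket_nonzero:
  assumes q: "q \<noteq> 0" "norm q < 1" and "u \<noteq> 0" "m > 0"
  shows "\<forall>\<^sub>\<approx>z\<in>- {0}. qbracket (z ^ m * u) q \<noteq> 0"
proof -
  have "\<forall>\<^sub>F w in at z. qbracket (w ^ m * u) q \<noteq> 0" if "z \<noteq> 0" for z
  proof -
    \<comment> \<open>\<open>norm s\<close> is not an integral power of \<open>norm q\<close>, so \<open>qbracket s q\<close> is nonzero.\<close>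
    define s where "s = complex_of_real (sqrt (norm q))"
    have s: "s \<noteq> 0" "norm s ^ 2 = norm q"
      using q by (auto simp: s_def)
    \<comment> \<open>An \<open>m\<close>-th root of \<open>s / u\<close>, so that the bracket at
      \<open>b\<close> is \<open>qbracket s q\<close>.\<close>
    define b where "b = exp (Ln (s / u) / of_nat m)"
    have b: "b ^ m = s / u"
      using assms s by (simp add: b_def flip: exp_of_nat_mult)
    have "qbracket s q \<noteq> 0"
    proof
      assume "qbracket s q = 0"
      then obtain k where "s = q powi k"
        using qbracket_eq_0_iff[OF q(2,1) s(1)] by blast
      then have "norm q powi (2 * k) = norm q powi 1"
        using s(2) by (simp add: norm_power_int power_int_mult mult.commute)
      moreover have "2 * k \<noteq> 1"
        by presburger
      ultimately show False
        using power_int_strict_decreasing[of "2 * k" 1 "norm q"]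
          power_int_strict_decreasing[of 1 "2 * k" "norm q"] q
        by (cases "2 * k" "1 :: int" rule: linorder_cases) auto
    qed
    then have "qbracket (b ^ m * u) q \<noteq> 0"
      using b assms by simp
    moreover have "(\<lambda>w. qbracket (w ^ m * u) q) holomorphic_on - {0}"
      using assms by (intro analytic_imp_holomorphic analytic_intros) auto
    moreover have "connected (- {0::complex})"
      by (intro connected_punctured_universe) simp
    ultimately have "\<forall>\<^sub>F w in at z. qbracket (w ^ m * u) q \<noteq> 0 \<and> w \<in> - {0}"
      using that by (intro non_zero_neighbour_alt[where \<beta> = b]) (auto simp: b_def)
    then show ?thesis
      by eventually_elim simp
  qed
  then show ?thesis
    by (simp add: eventually_cosparse_open_eq open_Compl)
qed

section \<open>The identity pointwise and as meromorphic functions\<close>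

theorem theorem4p5:
  fixes a :: nat and q :: complex
  assumes "a > 0" and "0 < norm q" and "norm q < 1"
  shows "let L = (\<lambda>z::complex. qbracket (z ^ a) q / qbracket2 z (z ^ (a + 1)) q);
             R = (\<lambda>z::complex. euler_E (q ^ (a + 1)) ^ 2 / euler_E q ^ 2 *
                   (\<Sum>j = 0..a - 1. z ^ j * (qbracket (q ^ (a - j)) (q ^ (a + 1)) /
                      qbracket2 (z ^ (a + 1)) (z ^ (a + 1) * q ^ (a - j)) (q ^ (a + 1)))))
         in L meromorphic_on (- {0}) \<and> R meromorphic_on (- {0}) \<and>
            (\<forall>\<^sub>\<approx>z\<in>- {0}. L z = R z) \<and>
            (\<forall>z. z \<noteq> 0 \<and> qbracket2 z (z ^ (a + 1)) q \<noteq> 0 \<and>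
                 (\<forall>j\<in>{0..a - 1}.
                    qbracket2 (z ^ (a + 1)) (z ^ (a + 1) * q ^ (a - j)) (q ^ (a + 1)) \<noteq> 0)
                 \<longrightarrow> L z = R z)"
proof -
  define N where "N = a + 1"
  define Q where "Q = q ^ N"
  have N_pos: "N > 0"
    by (simp add: N_def)
  have q: "q \<noteq> 0" "norm q < 1"
    using assms by auto
  have Q: "Q \<noteq> 0" "norm Q < 1"
    using q by (auto simp: Q_def N_def norm_power power_less_one_iff simp del: power_Suc)
  define L where "L = (\<lambda>z::complex. qbracket (z ^ a) q / qbracket2 z (z ^ N) q)"
  define R where "R = (\<lambda>z::complex. euler_E Q ^ 2 / euler_E q ^ 2 *
    (\<Sum>j = 0..a - 1. z ^ j * (qbracket (q ^ (a - j)) Q / qbracket2 (z ^ N) (z ^ N * q ^ (a - j)) Q)))"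
  have eq: "L z = R z"
    if "z \<noteq> 0" and nz1: "qbracket2 z (z ^ N) q \<noteq> 0"
      and nz2: "\<And>j. j \<in> {0..a - 1} \<Longrightarrow> qbracket2 (z ^ N) (z ^ N * q ^ (a - j)) Q \<noteq> 0" for z
  proof -
    have z1: "qbracket (1 / z) q = - qbracket z q / z" "qbracket (1 / z ^ N) Q = - qbracket (z ^ N) Q / z ^ N"
      using qbracket_inverse[OF q(2,1) \<open>z \<noteq> 0\<close>] qbracket_inverse[OF Q(2,1), of "z ^ N"] \<open>z \<noteq> 0\<close>
      by auto
    have nz: "qbracket z q \<noteq> 0" "qbracket (z ^ N) q \<noteq> 0" "qbracket (z ^ N) Q \<noteq> 0"
      using nz1 nz2[of 0] by (auto simp: qbracket2_def)
    \<comment> \<open>The index \<open>j = 0\<close> supplies \<open>r = 0\<close> through the first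
      bracket, and \<open>j = a - r\<close> supplies \<open>r\<close> from 1 to
      \<open>a\<close>.\<close>
    have nz_r: "qbracket (z ^ N * q ^ r) Q \<noteq> 0" if "r < N" for r
    proof (cases "r = 0")
      case False
      then show ?thesis
        using nz2[of "a - r"] that by (auto simp: qbracket2_def N_def)
    qed (use nz in simp)
    have "z ^ a = 1 / z * z ^ N"
      using \<open>z \<noteq> 0\<close> by (simp add: N_def)
    \<comment> \<open>The factor \<open>- z\<close> comes from reflecting
      \<open>qbracket (1 / z) q\<close>.\<close>
    then have "- z * euler_E q ^ 2 * L z =
        euler_E q ^ 2 * qbracket (1 / z * z ^ N) q / (qbracket (1 / z) q * qbracket (z ^ N) q)"
      using \<open>z \<noteq> 0\<close> by (simp add: L_def qbracket2_def z1)
    also have "\<dots> = euler_E Q ^ 2 * (\<Sum>r<N. (1 / z) ^ r * qbracket ((1 / z) ^ N * z ^ N * q ^ r) Q /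
        (qbracket ((1 / z) ^ N) Q * qbracket (z ^ N * q ^ r) Q))"
      unfolding Q_def
      by (rule kronecker_dissection)
        (use q nz nz_r \<open>z \<noteq> 0\<close> in \<open>auto simp: z1 Q_def[symmetric] power_one_over N_pos\<close>)
    also have "\<dots> = euler_E Q ^ 2 * (\<Sum>r<N. - (z ^ N / z ^ r * (qbracket (q ^ r) Q /
        qbracket2 (z ^ N) (z ^ N * q ^ r) Q)))"
      using \<open>z \<noteq> 0\<close> by (simp add: power_one_over z1 qbracket2_def mult.commute)
    \<comment> \<open>The summand \<open>r = 0\<close> drops out because its numerator is
      \<open>qbracket 1 Q = 0\<close>.\<close>
    also have "(\<Sum>r<N. - (z ^ N / z ^ r * (qbracket (q ^ r) Q / qbracket2 (z ^ N) (z ^ N * q ^ r) Q))) =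
        (\<Sum>r=1..a. - (z ^ N / z ^ r * (qbracket (q ^ r) Q / qbracket2 (z ^ N) (z ^ N * q ^ r) Q)))"
      using Q by (intro sum.mono_neutral_right) (auto simp: N_def Suc_le_eq)
    also have "\<dots> = (\<Sum>j=0..a-1. - (z * (z ^ j * (qbracket (q ^ (a - j)) Q /
        qbracket2 (z ^ N) (z ^ N * q ^ (a - j)) Q))))"
    \<comment> \<open>Substitute \<open>j = a - r\<close>; since \<open>N = a + 1\<close>, the
      quotient \<open>z ^ N / z ^ r\<close> is \<open>z * z ^ j\<close>.\<close>
    proof (rule sum.reindex_bij_witness[of _ "\<lambda>j. a - j" "\<lambda>r. a - r"])
      fix r assume r: "r \<in> {1..a}"
      then have "z ^ N = z ^ r * (z * z ^ (a - r))"
        by (simp add: N_def flip: power_add power_Suc)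
      then show "- (z * (z ^ (a - r) * (qbracket (q ^ (a - (a - r))) Q /
            qbracket2 (z ^ N) (z ^ N * q ^ (a - (a - r))) Q))) =
          - (z ^ N / z ^ r * (qbracket (q ^ r) Q / qbracket2 (z ^ N) (z ^ N * q ^ r) Q))"
        using r \<open>z \<noteq> 0\<close> by simp
    qed (use \<open>a > 0\<close> in auto)
    also have "euler_E Q ^ 2 * \<dots> = - z * euler_E q ^ 2 * R z"
      using euler_E_nonzero[OF q(2)] by (simp add: R_def sum_negf sum_distrib_left mult_ac)
    finally show ?thesis
      using \<open>z \<noteq> 0\<close> euler_E_nonzero[OF q(2)] by simp
  qed
  have "L meromorphic_on - {0}"
    unfolding L_def qbracket2_def using q
    by (intro meromorphic_intros analytic_on_imp_meromorphic_on analytic_on_qbracket analytic_intros)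
      auto
  moreover have "R meromorphic_on - {0}"
    unfolding R_def qbracket2_def using q Q
    by (intro meromorphic_intros analytic_on_imp_meromorphic_on analytic_on_qbracket analytic_intros)
      auto
  moreover have "\<forall>\<^sub>\<approx>z\<in>- {0}. L z = R z"
  \<comment> \<open>The pointwise identity holds off the zeros of finitely many denominators, each
    of which is nonzero on a cosparse set.\<close>
  proof -
    have "\<forall>\<^sub>\<approx>z\<in>- {0}. z \<in> - {0::complex}"
      by (intro eventually_in_cosparse) auto
    moreover have "\<forall>\<^sub>\<approx>z\<in>- {0}. qbracket2 z (z ^ N) q \<noteq> 0"
      using eventually_qbracket_nonzero[OF q, of 1 1] eventually_qbracket_nonzero[OF q, of 1 N]
      by (auto simp: qbracket2_def N_def eventually_conj_iff)
    moreover have "\<forall>\<^sub>\<approx>z\<in>- {0}. \<forall>j\<in>{0..a - 1}. qbracket2 (z ^ N) (z ^ N * q ^ (a - j)) Q \<noteq> 0"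
      using eventually_qbracket_nonzero[OF Q, of 1 N] eventually_qbracket_nonzero[OF Q, of _ N] q
      by (auto simp: qbracket2_def N_def eventually_ball_finite_distrib eventually_conj_iff)
    ultimately show ?thesis
      by eventually_elim (use eq in auto)
  qed
  ultimately show ?thesis
    using eq unfolding Let_def L_def R_def Q_def N_def by blast
qed

end
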